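(* Let $S$ be a semigroup and let $P$ be a choice function on the collection of all $\theta_S$-classes of $S$. Then the Rees matrix semigroup $\mathcal{M}(S;S/\theta_S;P)$ can be embedded in an idempotent-free left simple semigroup if and only if $S$ is idempotent-free and the right colon congruence $\theta_S^{*}$ of $\theta_S$ is left cancellative.
   Context: For a semigroup $S$, $\theta_S$ is the congruence $\theta_S=\{(a,b)\in S\times S: xa=xb \text{ for all } x\in S\}$. For a congruence $\varrho$ on $S$, the right colon congruence of $\varrho$ is the congruence $\varrho^{*}=\{(a,b)\in S\times S: (sa,sb)\in\varrho\text{ for all } s\in S\}$. A congruence $\varrho$ on $S$ is left cancellative if the factor semigroup $S/\varrho$ is left cancellative, i.e. $(xa,xb)\in\varrho$ implies $(a,b)\in\varrho$ for all $x,a,b\in S$. For a semigroup $S$, a nonempty set $\Lambda$ and a mapping $P:\Lambda\to S$, $\mathcal{M}(S;\Lambda;P)$ denotes the Rees matrix semigroup whose underlying set is $S\times\Lambda$, with multiplication $(s,\lambda)(t,\mu)=(sP(\lambda)t,\mu)$. A choice function on the collection of all $\theta_S$-classes of $S$ is a mapping $P:S/\theta_S\to S$ with $P([s]_{\theta_S})\in[s]_{\theta_S}$ for every $s\in S$. A semigroup is idempotent-free if it contains no element $e$ with $e^2=e$. A semigroup is left simple if it has no proper left ideal. *)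

theory Defs
  imports Main "HOL-Library.FuncSet"
begin

text \<open>A semigroup is given by a carrier set and a binary operation; as usual, it is nonempty.
  The operation is only constrained on the carrier.\<close>

locale semigroup_on =
  fixes S :: "'a set" and mult :: "'a \<Rightarrow> 'a \<Rightarrow> 'a" (infixl \<open>\<cdot>\<close> 70)
  assumes nonempty: "S \<noteq> {}"
    and closed: "\<lbrakk>a \<in> S; b \<in> S\<rbrakk> \<Longrightarrow> a \<cdot> b \<in> S"
    and assoc: "\<lbrakk>a \<in> S; b \<in> S; c \<in> S\<rbrakk> \<Longrightarrow> (a \<cdot> b) \<cdot> c = a \<cdot> (b \<cdot> c)"

definition congruence_on :: "'a set \<Rightarrow> ('a \<Rightarrow> 'a \<Rightarrow> 'a) \<Rightarrow> ('a \<times> 'a) set \<Rightarrow> bool" where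
  "congruence_on S m r \<longleftrightarrow> equiv S r \<and>
     (\<forall>(a, b)\<in>r. \<forall>s\<in>S. (m s a, m s b) \<in> r \<and> (m a s, m b s) \<in> r)"

definition theta :: "'a set \<Rightarrow> ('a \<Rightarrow> 'a \<Rightarrow> 'a) \<Rightarrow> ('a \<times> 'a) set" where
  "theta S m = {(a, b) \<in> S \<times> S. \<forall>x\<in>S. m x a = m x b}"

definition right_colon ::
    "'a set \<Rightarrow> ('a \<Rightarrow> 'a \<Rightarrow> 'a) \<Rightarrow> ('a \<times> 'a) set \<Rightarrow> ('a \<times> 'a) set" where
  "right_colon S m r = {(a, b) \<in> S \<times> S. \<forall>s\<in>S. (m s a, m s b) \<in> r}"

text \<open>Left cancellativity of the factor semigroup modulo \<open>r\<close>, expressed on representatives.\<close>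

definition left_cancellative_cong ::
    "'a set \<Rightarrow> ('a \<Rightarrow> 'a \<Rightarrow> 'a) \<Rightarrow> ('a \<times> 'a) set \<Rightarrow> bool" where
  "left_cancellative_cong S m r \<longleftrightarrow>
     (\<forall>x\<in>S. \<forall>a\<in>S. \<forall>b\<in>S. (m x a, m x b) \<in> r \<longrightarrow> (a, b) \<in> r)"

definition class_choice :: "'a set \<Rightarrow> ('a \<times> 'a) set \<Rightarrow> ('a set \<Rightarrow> 'a) \<Rightarrow> bool" where
  "class_choice S r P \<longleftrightarrow> (\<forall>C \<in> S // r. P C \<in> C)"

definition rees_carrier :: "'a set \<Rightarrow> 'l set \<Rightarrow> ('a \<times> 'l) set" where
  "rees_carrier S \<Lambda> = S \<times> \<Lambda>"

definition rees_mult ::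
    "('a \<Rightarrow> 'a \<Rightarrow> 'a) \<Rightarrow> ('l \<Rightarrow> 'a) \<Rightarrow> 'a \<times> 'l \<Rightarrow> 'a \<times> 'l \<Rightarrow> 'a \<times> 'l" where
  "rees_mult m P = (\<lambda>(s, i) (t, j). (m (m s (P i)) t, j))"

definition idempotent_free :: "'a set \<Rightarrow> ('a \<Rightarrow> 'a \<Rightarrow> 'a) \<Rightarrow> bool" where
  "idempotent_free S m \<longleftrightarrow> \<not> (\<exists>e\<in>S. m e e = e)"

definition left_ideal_of :: "'a set \<Rightarrow> ('a \<Rightarrow> 'a \<Rightarrow> 'a) \<Rightarrow> 'a set \<Rightarrow> bool" where
  "left_ideal_of S m L \<longleftrightarrow> L \<noteq> {} \<and> L \<subseteq> S \<and> (\<forall>s\<in>S. \<forall>a\<in>L. m s a \<in> L)"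

definition left_simple :: "'a set \<Rightarrow> ('a \<Rightarrow> 'a \<Rightarrow> 'a) \<Rightarrow> bool" where
  "left_simple S m \<longleftrightarrow> (\<forall>L. left_ideal_of S m L \<longrightarrow> L = S)"

definition semigroup_embedding ::
    "'a set \<Rightarrow> ('a \<Rightarrow> 'a \<Rightarrow> 'a) \<Rightarrow> 'b set \<Rightarrow> ('b \<Rightarrow> 'b \<Rightarrow> 'b) \<Rightarrow> ('a \<Rightarrow> 'b) \<Rightarrow> bool" where
  "semigroup_embedding S m T n \<phi> \<longleftrightarrow>
     \<phi> \<in> S \<rightarrow> T \<and> inj_on \<phi> S \<and> (\<forall>a\<in>S. \<forall>b\<in>S. \<phi> (m a b) = n (\<phi> a) (\<phi> b))"

text \<open>HOL cannot quantify existentially over types, so the type in which the carrier of the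
  containing semigroup lives is a parameter.\<close>

definition embeddable_idempotent_free_left_simple ::
    "'b itself \<Rightarrow> 'a set \<Rightarrow> ('a \<Rightarrow> 'a \<Rightarrow> 'a) \<Rightarrow> bool" where
  "embeddable_idempotent_free_left_simple (_ :: 'b itself) S m \<longleftrightarrow>
     (\<exists>(T :: 'b set) n \<phi>. semigroup_on T n \<and> idempotent_free T n \<and> left_simple T n \<and>
        semigroup_embedding S m T n \<phi>)"

context semigroup_on
begin

lemma congruence_on_theta: "congruence_on S mult (theta S mult)"
  unfolding congruence_on_def
proof
  show "equiv S (theta S mult)"
    by (rule equivI) (auto simp: theta_def refl_on_def sym_def trans_def)
  show "\<forall>(a, b)\<in>theta S mult. \<forall>s\<in>S.
      (s \<cdot> a, s \<cdot> b) \<in> theta S mult \<and> (a \<cdot> s, b \<cdot> s) \<in> theta S mult"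
    using closed by (auto simp: theta_def simp flip: assoc)
qed

lemma congruence_on_right_colon:
  assumes "congruence_on S mult r"
  shows "congruence_on S mult (right_colon S mult r)"
  unfolding congruence_on_def
proof
  have eq: "equiv S r"
    and cong: "\<And>a b s. (a, b) \<in> r \<Longrightarrow> s \<in> S \<Longrightarrow> (a \<cdot> s, b \<cdot> s) \<in> r"
    using assms by (auto simp: congruence_on_def)
  have rfl: "\<And>a. a \<in> S \<Longrightarrow> (a, a) \<in> r" and sy: "sym r" and tr: "trans r"
    using eq by (auto simp: equiv_def refl_on_def)
  show "equiv S (right_colon S mult r)"
  proof (rule equivI)
    show "right_colon S mult r \<subseteq> S \<times> S" by (auto simp: right_colon_def)
    show "refl_on S (right_colon S mult r)"
      using closed rfl by (auto simp: right_colon_def refl_on_def)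
    show "sym (right_colon S mult r)"
      using sy by (auto simp: right_colon_def sym_def)
    show "trans (right_colon S mult r)"
      using tr unfolding right_colon_def trans_def by blast
  qed
  show "\<forall>(a, b)\<in>right_colon S mult r. \<forall>s\<in>S.
      (s \<cdot> a, s \<cdot> b) \<in> right_colon S mult r \<and> (a \<cdot> s, b \<cdot> s) \<in> right_colon S mult r"
    using closed cong by (auto simp: right_colon_def simp flip: assoc)
qed

lemma semigroup_on_rees:
  assumes "\<Lambda> \<noteq> {}" and "P \<in> \<Lambda> \<rightarrow> S"
  shows "semigroup_on (rees_carrier S \<Lambda>) (rees_mult mult P)"
proof
  show "rees_carrier S \<Lambda> \<noteq> {}" using nonempty assms by (auto simp: rees_carrier_def)
qed (use assms closed in \<open>auto simp: rees_carrier_def rees_mult_def Pi_iff assoc\<close>)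

end

end

theory Submission
  imports Defs
begin

text \<open>
  The proof rests on one condition, due to P. M. Cohn, that characterises the semigroups
  embeddable in an idempotent-free left simple semigroup: the semigroup is idempotent-free, and
  \<open>x a = x b\<close> for a single \<open>x\<close> already forces \<open>y a = y b\<close> for every \<open>y\<close>. The second part is called
  \<open>equalized_uniformly\<close> below.

  The condition is necessary because in a left simple semigroup every \<open>y\<close> is a left multiple
  \<open>t x\<close> of \<open>x\<close>, and both parts are inherited by subsemigroups.

  It is sufficient because of Teissier's semigroups. Left translations of a semigroup \<open>M\<close> with the
  condition act on \<open>M\<close> with an adjoined identity; all of them have the kernel \<open>\<theta>\<close> (extended
  trivially to the identity), their images meet each kernel class at most once, and no image meets
  the class of the identity. Taking \<open>|M|\<close> copies of this action makes the number of missed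
  classes as large as the number of all classes. The semigroup of all maps with these properties
  is left simple, since the missed classes leave enough room to solve \<open>g f = h\<close> for \<open>g\<close>, and it is
  idempotent-free, since an idempotent map of this kind would miss no class
  (\<open>left_divisible_teissier\<close>, \<open>idempotent_free_teissier\<close>, \<open>teissier_embedding\<close>).

  For the Rees matrix semigroup over \<open>S\<close> with a choice function on the \<open>\<theta>\<close>-classes as its
  sandwich matrix, Cohn's condition translates into the two properties of \<open>S\<close> in the theorem: as
  \<open>t P([s]) = t s\<close>, the entries of the matrix act from the right exactly as the elements
  of \<open>S\<close> do. Finally, an idempotent-free \<open>M\<close> with the condition is infinite, so the semigroup of maps
  obtained for it has at most \<open>2\<^bsup>|S|\<^esup>\<close> elements and can be realised on sets of elements of \<open>S\<close>.
\<close>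

unbundle cardinal_syntax

section \<open>Cohn's condition and its necessity\<close>

definition equalized_uniformly :: "'a set \<Rightarrow> ('a \<Rightarrow> 'a \<Rightarrow> 'a) \<Rightarrow> bool" where
  "equalized_uniformly S m \<longleftrightarrow>
     (\<forall>x\<in>S. \<forall>a\<in>S. \<forall>b\<in>S. m x a = m x b \<longrightarrow> (a, b) \<in> theta S m)"

lemma equalized_uniformlyD:
  assumes "equalized_uniformly S m" "m x a = m x b" "x \<in> S" "a \<in> S" "b \<in> S" "y \<in> S"
  shows "m y a = m y b"
proof -
  have "(a, b) \<in> theta S m" using assms(1-5) unfolding equalized_uniformly_def by blast
  then show ?thesis using assms(6) by (simp add: theta_def)
qed

lemma equalized_uniformlyI:
  assumes "\<And>x a b y. \<lbrakk>x \<in> S; a \<in> S; b \<in> S; m x a = m x b; y \<in> S\<rbrakk> \<Longrightarrow> m y a = m y b"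
  shows "equalized_uniformly S m"
  unfolding equalized_uniformly_def theta_def using assms by blast

text \<open>Left simplicity gives \<open>T x = T\<close>, so every \<open>y\<close> is some \<open>t x\<close>.\<close>

lemma left_simple_imp_equalized_uniformly:
  assumes sg: "semigroup_on T n" and ls: "left_simple T n"
  shows "equalized_uniformly T n"
proof -
  interpret semigroup_on T n by (rule sg)
  have "n y a = n y b" if h: "x \<in> T" "a \<in> T" "b \<in> T" "n x a = n x b" "y \<in> T" for x a b y
  proof -
    have "left_ideal_of T n ((\<lambda>t. n t x) ` T)"
      unfolding left_ideal_of_def using nonempty closed h(1)
      by (auto simp: assoc[symmetric])
    then have "(\<lambda>t. n t x) ` T = T" using ls by (auto simp: left_simple_def)
    then obtain t where t: "t \<in> T" "y = n t x" using h(5) by auto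
    show ?thesis using t h by (simp add: assoc)
  qed
  then show ?thesis by (rule equalized_uniformlyI)
qed

lemma embeddable_imp_cohn_conditions:
  assumes sg: "semigroup_on M m"
    and emb: "embeddable_idempotent_free_left_simple TYPE('b) M m"
  shows "idempotent_free M m" and "equalized_uniformly M m"
proof -
  interpret semigroup_on M m by (rule sg)
  obtain T n and \<phi> :: "'a \<Rightarrow> 'b" where T: "semigroup_on T n" "idempotent_free T n" "left_simple T n"
    and \<phi>: "semigroup_embedding M m T n \<phi>"
    using emb unfolding embeddable_idempotent_free_left_simple_def by auto
  have in_T: "\<And>a. a \<in> M \<Longrightarrow> \<phi> a \<in> T" and inj: "inj_on \<phi> M"
    and hom: "\<And>a b. a \<in> M \<Longrightarrow> b \<in> M \<Longrightarrow> \<phi> (m a b) = n (\<phi> a) (\<phi> b)"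
    using \<phi> by (auto simp: semigroup_embedding_def)
  show "idempotent_free M m"
    using T(2) in_T hom unfolding idempotent_free_def by metis
  have eu: "equalized_uniformly T n"
    using T by (intro left_simple_imp_equalized_uniformly)
  have "m y a = m y b" if h: "x \<in> M" "a \<in> M" "b \<in> M" "m x a = m x b" "y \<in> M" for x a b y
  proof -
    have "n (\<phi> x) (\<phi> a) = n (\<phi> x) (\<phi> b)" using h hom by metis
    from equalized_uniformlyD[OF eu this] have "n (\<phi> y) (\<phi> a) = n (\<phi> y) (\<phi> b)"
      using h in_T by auto
    then show ?thesis using inj h hom closed by (metis inj_onD)
  qed
  then show "equalized_uniformly M m" by (rule equalized_uniformlyI)
qed

section \<open>Teissier's semigroups\<close>

text \<open>Teissier's semigroup consists of the maps of \<open>X\<close> whose kernel is the kernel of \<open>r\<close>, whose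
  images meet each kernel class at most once, and which miss as many classes as there are. Such a map
  factors through \<open>r\<close>, and it is represented here by the induced map on the set \<open>r ` X\<close> of classes;
  composition then becomes the sandwich product \<open>f \<circ> r \<circ> g\<close>. The size of the set of missed classes
  is expressed by an injection \<open>k\<close> of all classes into the missed ones.\<close>

definition teissier :: "'x set \<Rightarrow> ('x \<Rightarrow> 'q) \<Rightarrow> ('q \<Rightarrow> 'x) set" where
  "teissier X r = {f \<in> r ` X \<rightarrow>\<^sub>E X. inj_on (r \<circ> f) (r ` X) \<and>
     (\<exists>k. inj_on k (r ` X) \<and> k ` r ` X \<subseteq> r ` X - (r \<circ> f) ` r ` X)}"

definition teissier_mult :: "'x set \<Rightarrow> ('x \<Rightarrow> 'q) \<Rightarrow> ('q \<Rightarrow> 'x) \<Rightarrow> ('q \<Rightarrow> 'x) \<Rightarrow> 'q \<Rightarrow> 'x" where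
  "teissier_mult X r f g = (\<lambda>q\<in>r ` X. f (r (g q)))"

lemma teissierE:
  assumes "f \<in> teissier X r"
  obtains k where "f \<in> r ` X \<rightarrow>\<^sub>E X" "inj_on (r \<circ> f) (r ` X)"
    "inj_on k (r ` X)" "k ` r ` X \<subseteq> r ` X - (r \<circ> f) ` r ` X"
  using assms by (auto simp: teissier_def)

lemma teissierI:
  assumes "f \<in> r ` X \<rightarrow>\<^sub>E X" "inj_on (r \<circ> f) (r ` X)"
    "inj_on k (r ` X)" "k ` r ` X \<subseteq> r ` X - (r \<circ> f) ` r ` X"
  shows "f \<in> teissier X r"
  using assms by (auto simp: teissier_def)

lemma teissier_mult_closed:
  assumes f: "f \<in> teissier X r" and g: "g \<in> teissier X r"
  shows "teissier_mult X r f g \<in> teissier X r"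
proof -
  define Q where "Q = r ` X"
  obtain k where fX: "f \<in> Q \<rightarrow>\<^sub>E X" and fi: "inj_on (r \<circ> f) Q"
    and k: "inj_on k Q" "k ` Q \<subseteq> Q - (r \<circ> f) ` Q"
    using f unfolding Q_def by (rule teissierE)
  have gX: "g \<in> Q \<rightarrow>\<^sub>E X" and gi: "inj_on (r \<circ> g) Q"
    using g unfolding Q_def by (auto elim: teissierE)
  have rg: "r (g q) \<in> Q" if "q \<in> Q" for q using that gX unfolding Q_def by blast
  show ?thesis
  proof (rule teissierI, fold Q_def)
    show "teissier_mult X r f g \<in> Q \<rightarrow>\<^sub>E X"
      unfolding teissier_mult_def Q_def[symmetric] restrict_PiE_iff
      using PiE_mem[OF fX rg] by blast
    show "inj_on (r \<circ> teissier_mult X r f g) Q"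
    proof (rule inj_onI)
      fix u v assume uv: "u \<in> Q" "v \<in> Q"
        "(r \<circ> teissier_mult X r f g) u = (r \<circ> teissier_mult X r f g) v"
      then have "(r \<circ> f) (r (g u)) = (r \<circ> f) (r (g v))"
        by (simp add: teissier_mult_def Q_def[symmetric])
      from inj_onD[OF fi this rg[OF uv(1)] rg[OF uv(2)]]
      have "(r \<circ> g) u = (r \<circ> g) v" by simp
      then show "u = v" using uv(1,2) by (rule inj_onD[OF gi])
    qed
    show "inj_on k Q" by (fact k)
    show "k ` Q \<subseteq> Q - (r \<circ> teissier_mult X r f g) ` Q"
    proof -
      have "(r \<circ> teissier_mult X r f g) ` Q \<subseteq> (r \<circ> f) ` Q"
      proof (rule image_subsetI)
        fix x assume x: "x \<in> Q"
        then have "(r \<circ> teissier_mult X r f g) x = (r \<circ> f) (r (g x))"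
          by (simp add: teissier_mult_def Q_def[symmetric])
        then show "(r \<circ> teissier_mult X r f g) x \<in> (r \<circ> f) ` Q"
          using rg[OF x] by (rule image_eqI)
      qed
      then show ?thesis using k(2) by blast
    qed
  qed
qed

lemma semigroup_on_teissier:
  assumes "teissier X r \<noteq> {}"
  shows "semigroup_on (teissier X r) (teissier_mult X r)"
proof
  fix f g h assume fgh: "f \<in> teissier X r" "g \<in> teissier X r" "h \<in> teissier X r"
  show "teissier_mult X r (teissier_mult X r f g) h = teissier_mult X r f (teissier_mult X r g h)"
  proof (rule ext)
    fix q
    show "teissier_mult X r (teissier_mult X r f g) h q
        = teissier_mult X r f (teissier_mult X r g h) q"
      using fgh(3) by (auto simp: teissier_mult_def teissier_def)
  qed
qed (use assms teissier_mult_closed in auto)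

text \<open>If \<open>f\<close> is idempotent, cancelling the injective map \<open>r \<circ> f\<close> shows that \<open>r \<circ> f\<close> is the identity on
  the classes; but then no class is missed.\<close>

lemma idempotent_free_teissier:
  assumes "X \<noteq> {}"
  shows "idempotent_free (teissier X r) (teissier_mult X r)"
  unfolding idempotent_free_def
proof
  assume "\<exists>f\<in>teissier X r. teissier_mult X r f f = f"
  then obtain f where f: "f \<in> teissier X r" and ff: "teissier_mult X r f f = f" by auto
  obtain k where fX: "f \<in> r ` X \<rightarrow>\<^sub>E X" and fi: "inj_on (r \<circ> f) (r ` X)"
    and k: "k ` r ` X \<subseteq> r ` X - (r \<circ> f) ` r ` X"
    using f by (rule teissierE)
  have id: "r (f q) = q" if q: "q \<in> r ` X" for q
  proof -
    have "f (r (f q)) = f q" using ff q by (metis restrict_apply' teissier_mult_def)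
    then have "(r \<circ> f) (r (f q)) = (r \<circ> f) q" by simp
    moreover have "r (f q) \<in> r ` X" using fX q by blast
    ultimately show ?thesis using fi q by (blast dest: inj_onD)
  qed
  then have "(r \<circ> f) ` r ` X = r ` X" by (auto simp: image_image)
  then show False using k assms by auto
qed

lemma infinite_self_doubling:
  assumes "infinite Q"
  obtains p q where "inj_on p Q" "inj_on q Q" "p ` Q \<subseteq> Q" "q ` Q \<subseteq> Q" "p ` Q \<inter> q ` Q = {}"
proof -
  have "|Q <+> Q| =o |Q|" using assms by (intro card_of_Plus_infinite1) (auto simp: card_of_mono1)
  then obtain g where g: "bij_betw g (Q <+> Q) Q" by (auto simp: card_of_ordIso[symmetric])
  show thesis
  proof (rule that[of "g \<circ> Inl" "g \<circ> Inr"])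
    show "inj_on (g \<circ> Inl) Q" "inj_on (g \<circ> Inr) Q"
      using g by (auto simp: bij_betw_def inj_on_def)
    show "(g \<circ> Inl) ` Q \<subseteq> Q" "(g \<circ> Inr) ` Q \<subseteq> Q" using g by (auto simp: bij_betw_def)
    show "(g \<circ> Inl) ` Q \<inter> (g \<circ> Inr) ` Q = {}"
      using g by (auto simp: bij_betw_def inj_on_def)
  qed
qed

text \<open>The equation \<open>g f = h\<close> prescribes \<open>g\<close> on the classes met by \<open>f\<close>. The other classes are sent
  injectively into one half of the classes missed by \<open>h\<close>; the other half is still missed by
  \<open>g\<close>.\<close>

lemma left_divisible_teissier:
  assumes inf: "infinite (r ` X)" and f: "f \<in> teissier X r" and h: "h \<in> teissier X r"
  obtains g where "g \<in> teissier X r" "teissier_mult X r g f = h"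
proof -
  define Q where "Q = r ` X"
  have fX: "f \<in> Q \<rightarrow>\<^sub>E X" and fi: "inj_on (r \<circ> f) Q"
    using f unfolding Q_def by (auto elim: teissierE)
  obtain k where hX: "h \<in> Q \<rightarrow>\<^sub>E X" and hi: "inj_on (r \<circ> h) Q"
    and k: "inj_on k Q" "k ` Q \<subseteq> Q - (r \<circ> h) ` Q"
    using h unfolding Q_def by (rule teissierE)
  obtain p q where p: "inj_on p Q" "p ` Q \<subseteq> Q" and q: "inj_on q Q" "q ` Q \<subseteq> Q"
    and pq: "p ` Q \<inter> q ` Q = {}"
    using infinite_self_doubling inf unfolding Q_def by metis
  define s where "s = inv_into Q (r \<circ> f)"
  define g where "g = (\<lambda>z\<in>Q. if z \<in> (r \<circ> f) ` Q then h (s z) else inv_into X r (k (p z)))"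
  have rf: "r (f x) \<in> Q" if "x \<in> Q" for x using that fX unfolding Q_def by blast
  have sQ: "s z \<in> Q" if "z \<in> (r \<circ> f) ` Q" for z
    using that unfolding s_def by (rule inv_into_into)
  have s_inj: "z = w" if "s z = s w" "z \<in> (r \<circ> f) ` Q" "w \<in> (r \<circ> f) ` Q" for z w
    using that unfolding s_def by (rule inv_into_injective)
  have s_f: "s (r (f x)) = x" if "x \<in> Q" for x
    using inv_into_f_f[OF fi that] by (simp add: s_def)
  have hsX: "h (s z) \<in> X" if "z \<in> (r \<circ> f) ` Q" for z
    using sQ[OF that] hX by blast
  have pQ: "p z \<in> Q" and qQ: "q z \<in> Q" if "z \<in> Q" for z using that p(2) q(2) by blast+
  have kQ: "k z \<in> Q" if "z \<in> Q" for z using that k(2) by blast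
  have kpQ: "k (p z) \<in> r ` X" if "z \<in> Q" for z
    using kQ pQ that by (simp add: Q_def[symmetric])
  have rg1: "r (g z) = r (h (s z))" if "z \<in> Q" "z \<in> (r \<circ> f) ` Q" for z
    using that by (simp only: g_def restrict_apply' if_True)
  have rg2: "r (g z) = k (p z)" if "z \<in> Q" "z \<notin> (r \<circ> f) ` Q" for z
    using that kpQ by (simp only: g_def restrict_apply' if_False f_inv_into_f)
  have k_h: "k z \<noteq> r (h y)" if "z \<in> Q" "y \<in> Q" for z y
  proof -
    have "r (h y) \<in> (r \<circ> h) ` Q" using that(2) by (intro image_eqI[of _ _ y]) simp_all
    moreover have "k z \<notin> (r \<circ> h) ` Q" using that(1) k(2) by blast
    ultimately show ?thesis by metis
  qed
  have kp_inj: "z = w" if "k (p z) = k (p w)" "z \<in> Q" "w \<in> Q" for z w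
    using inj_onD[OF p(1)] inj_onD[OF k(1)] that pQ by blast
  have h_inj: "y = x" if "r (h y) = r (h x)" "y \<in> Q" "x \<in> Q" for y x
    using inj_onD[OF hi, of y x] that by simp
  show thesis
  proof (rule that)
    show "g \<in> teissier X r"
    proof (rule teissierI, fold Q_def)
      show "g \<in> Q \<rightarrow>\<^sub>E X"
        using hsX kpQ unfolding g_def
        by (auto intro!: inv_into_into simp del: comp_apply image_iff)
      show "inj_on (r \<circ> g) Q"
      proof (rule inj_onI)
        fix z w assume zw: "z \<in> Q" "w \<in> Q" "(r \<circ> g) z = (r \<circ> g) w"
        then have e: "r (g z) = r (g w)" by simp
        show "z = w"
        proof (cases "z \<in> (r \<circ> f) ` Q"; cases "w \<in> (r \<circ> f) ` Q")
          assume "z \<in> (r \<circ> f) ` Q" "w \<in> (r \<circ> f) ` Q"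
          then show ?thesis using e zw rg1 h_inj sQ s_inj by metis
        next
          assume "z \<in> (r \<circ> f) ` Q" "w \<notin> (r \<circ> f) ` Q"
          then show ?thesis using e zw rg1 rg2 k_h pQ sQ by metis
        next
          assume "z \<notin> (r \<circ> f) ` Q" "w \<in> (r \<circ> f) ` Q"
          then show ?thesis using e zw rg1 rg2 k_h pQ sQ by metis
        next
          assume "z \<notin> (r \<circ> f) ` Q" "w \<notin> (r \<circ> f) ` Q"
          then show ?thesis using e zw rg2 kp_inj by metis
        qed
      qed
      show "inj_on (k \<circ> q) Q"
        using q k(1) by (intro comp_inj_on) (auto intro: inj_on_subset)
      have "k (q x) \<noteq> r (g z)" if "x \<in> Q" "z \<in> Q" for x z
      proof (cases "z \<in> (r \<circ> f) ` Q")
        case True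
        then show ?thesis using rg1 that sQ k_h qQ by metis
      next
        case False
        have "p z \<noteq> q x" using pq that by blast
        then show ?thesis using rg2 False that inj_onD[OF k(1)] pQ qQ by metis
      qed
      then show "(k \<circ> q) ` Q \<subseteq> Q - (r \<circ> g) ` Q"
        using kQ qQ by auto
    qed
    show "teissier_mult X r g f = h"
    proof (rule ext)
      fix x
      show "teissier_mult X r g f x = h x"
      proof (cases "x \<in> Q")
        case True
        then have "r (f x) \<in> (r \<circ> f) ` Q" by auto
        then show ?thesis using True rf s_f by (simp add: teissier_mult_def Q_def[symmetric] g_def)
      next
        case False
        then show ?thesis using hX by (auto simp: teissier_mult_def Q_def[symmetric])
      qed
    qed
  qed
qed

lemma left_simple_teissier:
  assumes "infinite (r ` X)"
  shows "left_simple (teissier X r) (teissier_mult X r)"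
  unfolding left_simple_def
proof (intro allI impI)
  fix L assume L: "left_ideal_of (teissier X r) (teissier_mult X r) L"
  then obtain f where f: "f \<in> L" "f \<in> teissier X r" by (auto simp: left_ideal_of_def)
  have "h \<in> L" if h: "h \<in> teissier X r" for h
  proof -
    obtain g where "g \<in> teissier X r" "teissier_mult X r g f = h"
      using left_divisible_teissier[OF assms f(2) h] .
    then show ?thesis using L f unfolding left_ideal_of_def by blast
  qed
  then show "L = teissier X r" using L by (auto simp: left_ideal_of_def)
qed

section \<open>Left translations inside a Teissier semigroup\<close>

text \<open>The translation by \<open>a\<close> acts on \<open>M\<close> with an adjoined identity, which is \<open>None\<close>. The second
  coordinate indexes the copies of this action.\<close>

definition left_translation :: "('m \<Rightarrow> 'm \<Rightarrow> 'm) \<Rightarrow> 'm \<Rightarrow> 'm option \<times> 'm \<Rightarrow> 'm option \<times> 'm" where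
  "left_translation m a = (\<lambda>(u, y). (Some (case u of None \<Rightarrow> a | Some x \<Rightarrow> m a x), y))"

definition translation_domain :: "'m set \<Rightarrow> ('m option \<times> 'm) set" where
  "translation_domain M = insert None (Some ` M) \<times> M"

text \<open>The kernel classes of the translations are represented by chosen elements.\<close>

definition theta_rep :: "'m set \<Rightarrow> ('m \<Rightarrow> 'm \<Rightarrow> 'm) \<Rightarrow> 'm option \<times> 'm \<Rightarrow> 'm option \<times> 'm" where
  "theta_rep M m = (\<lambda>(u, y). (map_option (\<lambda>x. SOME x'. (x, x') \<in> theta M m) u, y))"

locale cohn_semigroup = semigroup_on M m
  for M :: "'m set" and m :: "'m \<Rightarrow> 'm \<Rightarrow> 'm" +
  assumes idempotent_free: "idempotent_free M m"
    and equalized_uniformly: "equalized_uniformly M m"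
begin

abbreviation X where "X \<equiv> translation_domain M"
abbreviation r where "r \<equiv> theta_rep M m"
abbreviation Q where "Q \<equiv> r ` X"

definition rep where "rep x = (SOME x'. (x, x') \<in> theta M m)"

lemma theta_rep_simps [simp]:
  "r (None, y) = (None, y)" "r (Some x, y) = (Some (rep x), y)"
  by (simp_all add: theta_rep_def rep_def)

lemma left_translation_simps [simp]:
  "left_translation m a (None, y) = (Some a, y)"
  "left_translation m a (Some x, y) = (Some (m a x), y)"
  by (simp_all add: left_translation_def)

lemma rep_theta:
  assumes "x \<in> M" shows "(x, rep x) \<in> theta M m"
  unfolding rep_def by (rule someI[of _ x]) (use assms in \<open>simp add: theta_def\<close>)

lemma rep_closed: "x \<in> M \<Longrightarrow> rep x \<in> M"
  using rep_theta by (auto simp: theta_def)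

lemma mult_rep: "x \<in> M \<Longrightarrow> y \<in> M \<Longrightarrow> m y (rep x) = m y x"
  using rep_theta by (auto simp: theta_def)

lemma rep_eq_mult_eq: "rep x = rep x' \<Longrightarrow> x \<in> M \<Longrightarrow> x' \<in> M \<Longrightarrow> y \<in> M \<Longrightarrow> m y x = m y x'"
  using mult_rep by metis

lemma rep_eqI:
  assumes "(x, x') \<in> theta M m" shows "rep x = rep x'"
proof -
  have "(x, z) \<in> theta M m \<longleftrightarrow> (x', z) \<in> theta M m" for z
    using assms by (auto simp: theta_def)
  then show ?thesis by (simp add: rep_def)
qed

lemma equalized: "m x a = m x b \<Longrightarrow> x \<in> M \<Longrightarrow> a \<in> M \<Longrightarrow> b \<in> M \<Longrightarrow> y \<in> M \<Longrightarrow> m y a = m y b"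
  using equalized_uniformlyD[OF equalized_uniformly] .

text \<open>The classes of \<open>a x\<close> and \<open>a\<close> differ, that is, a translation never identifies \<open>x\<close> with the
  adjoined identity. Otherwise \<open>z a x = z a\<close>, hence \<open>(z a) (x x) = (z a) x\<close> and, by Cohn's condition,
  \<open>x x x = x x\<close>; then \<open>x x\<close> is idempotent.\<close>

lemma rep_mult_neq:
  assumes a: "a \<in> M" and x: "x \<in> M"
  shows "rep (m a x) \<noteq> rep a"
proof
  assume "rep (m a x) = rep a"
  then have "m a (m a x) = m a a" using a x closed rep_eq_mult_eq by blast
  then have "m (m a a) (m x x) = m (m a a) x" using a x closed by (simp add: assoc[symmetric])
  then have "m x (m x x) = m x x" using a x closed equalized by blast
  then have "m (m x x) (m x x) = m x x" using x closed by (simp add: assoc)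
  then show False using idempotent_free x closed by (auto simp: idempotent_free_def)
qed

text \<open>If \<open>a x\<close> and \<open>a x'\<close> are in the same class, one further left multiplication by \<open>a\<close> turns this into
  an equation, to which Cohn's condition applies.\<close>

lemma theta_cancel:
  assumes e: "rep (m a x) = rep (m a x')" and M: "a \<in> M" "x \<in> M" "x' \<in> M"
  shows "rep x = rep x'"
proof (rule rep_eqI)
  have "m a (m a x) = m a (m a x')" using e M closed rep_eq_mult_eq by blast
  then have "m (m a a) x = m (m a a) x'" using M by (simp add: assoc)
  from equalized[OF this] show "(x, x') \<in> theta M m" using M closed by (simp add: theta_def)
qed

lemma classes_eq: "Q = insert None (Some ` rep ` M) \<times> M"
proof
  show "Q \<subseteq> insert None (Some ` rep ` M) \<times> M" by (auto simp: translation_domain_def)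
  show "insert None (Some ` rep ` M) \<times> M \<subseteq> Q"
  proof (clarify, elim insertE imageE; clarify)
    fix y assume "y \<in> M"
    then show "(None, y) \<in> Q"
      by (intro image_eqI[of _ _ "(None, y)"]) (auto simp: translation_domain_def)
  next
    fix y x assume "y \<in> M" "x \<in> M"
    then show "(Some (rep x), y) \<in> Q"
      by (intro image_eqI[of _ _ "(Some x, y)"]) (auto simp: translation_domain_def)
  qed
qed

lemma left_translation_in_domain:
  assumes "a \<in> M" "z \<in> Q" shows "left_translation m a z \<in> X"
  using assms by (auto simp: classes_eq translation_domain_def closed rep_closed)

lemma left_translation_rep:
  assumes "a \<in> M" "z \<in> X" shows "left_translation m a (r z) = left_translation m a z"
  using assms by (auto simp: translation_domain_def mult_rep)

lemma left_translation_comp: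
  assumes "a \<in> M" "b \<in> M" "z \<in> Q"
  shows "left_translation m (m a b) z = left_translation m a (left_translation m b z)"
  using assms by (auto simp: classes_eq assoc rep_closed)

lemma left_translation_inj:
  assumes "a \<in> M" shows "inj_on (r \<circ> left_translation m a) Q"
proof (rule inj_onI)
  fix z w assume zw: "z \<in> Q" "w \<in> Q"
    and e: "(r \<circ> left_translation m a) z = (r \<circ> left_translation m a) w"
  have red: "rep (m a (rep x)) = rep (m a x)" if "x \<in> M" for x using mult_rep assms that by simp
  show "z = w"
    using zw e unfolding classes_eq
    by (auto simp: red rep_mult_neq[OF assms] rep_mult_neq[OF assms, symmetric]
        intro: theta_cancel[OF _ assms])
qed

lemma left_translation_misses_identity:
  "(None, y) \<notin> (r \<circ> left_translation m a) ` Q"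
  by (auto simp: classes_eq)

text \<open>A translation induces an injection on the classes that is not surjective.\<close>

lemma infinite_classes: "infinite Q"
proof
  assume fin: "finite Q"
  obtain a where a: "a \<in> M" using nonempty by auto
  have "(r \<circ> left_translation m a) ` Q \<subseteq> Q"
    by (intro image_subsetI) (simp add: imageI left_translation_in_domain[OF a])
  from endo_inj_surj[OF fin this left_translation_inj[OF a]]
  have "(None, a) \<in> (r \<circ> left_translation m a) ` Q" using a by (auto simp: classes_eq)
  then show False using left_translation_misses_identity by blast
qed

lemma infinite_carrier: "infinite M"
proof
  assume "finite M"
  then have "finite Q" by (auto simp: classes_eq)
  then show False using infinite_classes by simp
qed

lemma domain_card: "|X| \<le>o |M|"
proof -
  have "infinite (Some ` M)" using infinite_carrier by (simp add: finite_image_iff)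
  from infinite_imp_bij_betw2[OF this, of None]
  obtain h where "bij_betw h (Some ` M) (Some ` M \<union> {None})" ..
  then have "|Some ` M| =o |insert None (Some ` M)|" using card_of_ordIsoI by (metis Un_insert_right sup_bot_right)
  then have "|insert None (Some ` M)| \<le>o |M|"
    using card_of_image ordIso_symmetric ordIso_ordLeq_trans by blast
  then show ?thesis
    unfolding translation_domain_def
    by (intro card_of_Sigma_ordLeq_infinite infinite_carrier ballI) (simp_all add: card_of_mono1)
qed

text \<open>The missed classes include a copy of the adjoined identity for each element of \<open>M\<close>, and there
  are only \<open>|M|\<close> classes altogether.\<close>

lemma left_translation_in_teissier:
  assumes a: "a \<in> M"
  shows "restrict (left_translation m a) Q \<in> teissier X r"
proof -
  have "|Q| \<le>o |M|" using card_of_image domain_card ordLeq_transitive by blast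
  then obtain k where k: "inj_on k Q" "k ` Q \<subseteq> M" by (auto simp: card_of_ordLeq[symmetric])
  show ?thesis
  proof (rule teissierI)
    show "restrict (left_translation m a) Q \<in> Q \<rightarrow>\<^sub>E X"
      by (simp add: restrict_PiE_iff left_translation_in_domain[OF a])
    show "inj_on (r \<circ> restrict (left_translation m a) Q) Q"
      using left_translation_inj[OF a] by (simp add: inj_on_def)
    show "inj_on (\<lambda>z. (None, k z)) Q" using k by (auto simp: inj_on_def)
    have "(r \<circ> restrict (left_translation m a) Q) ` Q = (r \<circ> left_translation m a) ` Q"
      by (intro image_cong) auto
    then show "(\<lambda>z. (None, k z)) ` Q \<subseteq> Q - (r \<circ> restrict (left_translation m a) Q) ` Q"
      using k left_translation_misses_identity by (auto simp: classes_eq)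
  qed
qed

lemma teissier_embedding:
  "semigroup_embedding M m (teissier X r) (teissier_mult X r)
     (\<lambda>a. restrict (left_translation m a) Q)"
  unfolding semigroup_embedding_def
proof (intro conjI ballI)
  show "(\<lambda>a. restrict (left_translation m a) Q) \<in> M \<rightarrow> teissier X r"
    using left_translation_in_teissier by auto
  show "inj_on (\<lambda>a. restrict (left_translation m a) Q) M"
  proof (rule inj_onI)
    fix a b assume a: "a \<in> M" and "b \<in> M"
      and e: "restrict (left_translation m a) Q = restrict (left_translation m b) Q"
    \<comment> \<open>The images of the adjoined identity recover \<open>a\<close> and \<open>b\<close>.\<close>
    have "(None, a) \<in> Q" using a by (auto simp: classes_eq)
    then have "left_translation m a (None, a) = left_translation m b (None, a)"
      using e by (metis restrict_apply')
    then show "a = b" by simp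
  qed
  fix a b assume ab: "a \<in> M" "b \<in> M"
  show "restrict (left_translation m (m a b)) Q
      = teissier_mult X r (restrict (left_translation m a) Q) (restrict (left_translation m b) Q)"
    unfolding teissier_mult_def
    using ab left_translation_in_domain left_translation_rep left_translation_comp
    by (intro restrict_ext) simp
qed

lemma teissier_idempotent_free_left_simple:
  "semigroup_on (teissier X r) (teissier_mult X r)"
  "idempotent_free (teissier X r) (teissier_mult X r)"
  "left_simple (teissier X r) (teissier_mult X r)"
proof -
  show "semigroup_on (teissier X r) (teissier_mult X r)"
    using nonempty left_translation_in_teissier by (intro semigroup_on_teissier) blast
  show "idempotent_free (teissier X r) (teissier_mult X r)"
    using nonempty by (intro idempotent_free_teissier) (auto simp: translation_domain_def)
  show "left_simple (teissier X r) (teissier_mult X r)"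
    using infinite_classes by (rule left_simple_teissier)
qed

end

section \<open>Realisation on a prescribed type\<close>

lemma embeddable_transport:
  fixes c :: "'t \<Rightarrow> 'b"
  assumes c: "inj_on c T" and sg: "semigroup_on T n" and idf: "idempotent_free T n"
    and ls: "left_simple T n" and emb: "semigroup_embedding M m T n \<phi>"
  shows "embeddable_idempotent_free_left_simple TYPE('b) M m"
proof -
  interpret semigroup_on T n by (rule sg)
  define d where "d = inv_into T c"
  define n' where "n' u v = c (n (d u) (d v))" for u v
  have dc [simp]: "d (c t) = t" if "t \<in> T" for t using c that by (simp add: d_def)
  have n'c [simp]: "n' (c s) (c t) = c (n s t)" if "s \<in> T" "t \<in> T" for s t
    using that by (simp add: n'_def)
  have "semigroup_on (c ` T) n'"
    by standard (auto simp: nonempty closed assoc)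
  moreover have "idempotent_free (c ` T) n'"
    unfolding idempotent_free_def
  proof
    assume "\<exists>e\<in>c ` T. n' e e = e"
    then obtain t where t: "t \<in> T" "c (n t t) = c t" by auto
    then have "n t t = t" using c closed by (blast dest: inj_onD)
    then show False using idf t by (auto simp: idempotent_free_def)
  qed
  moreover have "left_simple (c ` T) n'"
    unfolding left_simple_def
  proof (intro allI impI)
    fix L assume L: "left_ideal_of (c ` T) n' L"
    have "left_ideal_of T n {t \<in> T. c t \<in> L}"
      unfolding left_ideal_of_def
    proof (intro conjI ballI)
      show "{t \<in> T. c t \<in> L} \<noteq> {}" using L unfolding left_ideal_of_def by blast
      fix s t assume st: "s \<in> T" "t \<in> {t \<in> T. c t \<in> L}"
      then have "n' (c s) (c t) \<in> L" using L unfolding left_ideal_of_def by blast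
      then show "n s t \<in> {t \<in> T. c t \<in> L}" using st closed by simp
    qed auto
    then have "{t \<in> T. c t \<in> L} = T" using ls unfolding left_simple_def by blast
    then show "L = c ` T" using L unfolding left_ideal_of_def by blast
  qed
  moreover have "semigroup_embedding M m (c ` T) n' (c \<circ> \<phi>)"
    unfolding semigroup_embedding_def
  proof (intro conjI ballI)
    have \<phi>: "\<phi> ` M \<subseteq> T" "inj_on \<phi> M"
      using emb by (auto simp: semigroup_embedding_def)
    show "c \<circ> \<phi> \<in> M \<rightarrow> c ` T" using \<phi> by auto
    show "inj_on (c \<circ> \<phi>) M" using \<phi> inj_on_subset[OF c] by (blast intro: comp_inj_on)
    fix a b assume ab: "a \<in> M" "b \<in> M"
    then have "\<phi> a \<in> T" "\<phi> b \<in> T" using \<phi> by auto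
    then show "(c \<circ> \<phi>) (m a b) = n' ((c \<circ> \<phi>) a) ((c \<circ> \<phi>) b)"
      using emb ab by (simp add: semigroup_embedding_def)
  qed
  ultimately show ?thesis unfolding embeddable_idempotent_free_left_simple_def by blast
qed

lemma inj_on_graph_code:
  assumes e: "inj_on e (Q \<times> X)"
  shows "inj_on (\<lambda>f. e ` (\<lambda>q. (q, f q)) ` Q) (Q \<rightarrow>\<^sub>E X)"
proof (rule inj_onI)
  fix f g assume f: "f \<in> Q \<rightarrow>\<^sub>E X" and g: "g \<in> Q \<rightarrow>\<^sub>E X"
    and eq: "e ` (\<lambda>q. (q, f q)) ` Q = e ` (\<lambda>q. (q, g q)) ` Q"
  have "(\<lambda>q. (q, f q)) ` Q \<subseteq> Q \<times> X" "(\<lambda>q. (q, g q)) ` Q \<subseteq> Q \<times> X"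
    by (auto simp: PiE_mem[OF f] PiE_mem[OF g])
  then have graphs: "(\<lambda>q. (q, f q)) ` Q = (\<lambda>q. (q, g q)) ` Q"
    using eq by (simp only: inj_on_image_eq_iff[OF e])
  show "f = g"
  proof (rule PiE_ext[OF f g])
    fix q assume "q \<in> Q"
    then have "(q, f q) \<in> (\<lambda>q. (q, g q)) ` Q" unfolding graphs[symmetric] by (rule imageI)
    then show "f q = g q" by (elim imageE) simp
  qed
qed

text \<open>A map in the Teissier semigroup is coded by its graph, a subset of a set of at most \<open>|A|\<close>
  elements. The first component of the code is a dummy.\<close>

lemma (in cohn_semigroup) embeddable_in_powerset:
  fixes A :: "'a set"
  assumes A: "infinite A" and MA: "|M| \<le>o |A|"
  shows "embeddable_idempotent_free_left_simple TYPE('c \<times> 'a set) M m"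
proof -
  have XA: "|X| \<le>o |A|" using domain_card MA by (rule ordLeq_transitive)
  have QA: "|Q| \<le>o |A|" using card_of_image XA by (rule ordLeq_transitive)
  have "|Q \<times> X| \<le>o |A|" by (intro card_of_Sigma_ordLeq_infinite A QA ballI XA)
  then obtain e where e: "inj_on e (Q \<times> X)" and "e ` (Q \<times> X) \<subseteq> A"
    unfolding card_of_ordLeq[symmetric] by blast
  define c where "c f = (undefined :: 'c, e ` (\<lambda>q. (q, f q)) ` Q)" for f
  have "inj_on c (Q \<rightarrow>\<^sub>E X)"
    by (intro inj_onI inj_onD[OF inj_on_graph_code[OF e]]) (simp_all add: c_def)
  moreover have "teissier X r \<subseteq> Q \<rightarrow>\<^sub>E X" unfolding teissier_def by blast
  ultimately have "inj_on c (teissier X r)" by (rule inj_on_subset)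
  then show ?thesis
    using teissier_idempotent_free_left_simple teissier_embedding by (rule embeddable_transport)
qed

section \<open>Cohn's condition for the Rees matrix semigroup\<close>

locale theta_choice = semigroup_on S mult
  for S :: "'a set" and mult :: "'a \<Rightarrow> 'a \<Rightarrow> 'a" (infixl \<open>\<cdot>\<close> 70) +
  fixes P :: "'a set \<Rightarrow> 'a"
  assumes choice: "class_choice S (theta S mult) P"
begin

abbreviation \<Lambda> where "\<Lambda> \<equiv> S // theta S mult"
abbreviation M where "M \<equiv> rees_carrier S \<Lambda>"
abbreviation mm where "mm \<equiv> rees_mult mult P"

definition cls where "cls s = theta S mult `` {s}"

lemma cls_in: "s \<in> S \<Longrightarrow> cls s \<in> \<Lambda>"
  by (simp add: cls_def quotientI)

lemma P_closed:
  assumes "i \<in> \<Lambda>" shows "P i \<in> S"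
proof -
  have "P i \<in> i" using assms choice by (simp add: class_choice_def)
  moreover have "i \<subseteq> S" using assms by (auto simp: quotient_def theta_def)
  ultimately show ?thesis by blast
qed

lemma mult_P_cls:
  assumes "t \<in> S" "s \<in> S" shows "t \<cdot> P (cls s) = t \<cdot> s"
proof -
  have "P (cls s) \<in> cls s" using choice cls_in[OF assms(2)] by (simp add: class_choice_def)
  then show ?thesis using assms by (auto simp: cls_def theta_def)
qed

lemma rees_mult_simp [simp]: "mm (s, i) (t, j) = (s \<cdot> P i \<cdot> t, j)"
  by (simp add: rees_mult_def)

lemma in_rees: "(s, i) \<in> M \<longleftrightarrow> s \<in> S \<and> i \<in> \<Lambda>"
  by (simp add: rees_carrier_def)

lemma semigroup_rees: "semigroup_on M mm"
proof (rule semigroup_on_rees)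
  show "\<Lambda> \<noteq> {}" using nonempty cls_in by blast
  show "P \<in> \<Lambda> \<rightarrow> S" using P_closed by auto
qed

lemma in_right_colon_theta:
  "(a, b) \<in> right_colon S mult (theta S mult)
     \<longleftrightarrow> a \<in> S \<and> b \<in> S \<and> (\<forall>t\<in>S. \<forall>s\<in>S. t \<cdot> s \<cdot> a = t \<cdot> s \<cdot> b)"
  using closed by (auto simp: right_colon_def theta_def assoc)

text \<open>An idempotent \<open>e\<close> of \<open>S\<close> gives the idempotent \<open>(e, [e])\<close>, and an idempotent \<open>(s, i)\<close> of the
  matrix semigroup gives the idempotent \<open>P i \<cdot> s\<close> of \<open>S\<close>.\<close>

lemma idempotent_free_rees_iff: "idempotent_free M mm \<longleftrightarrow> idempotent_free S mult"
proof
  assume free: "idempotent_free M mm"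
  show "idempotent_free S mult"
    unfolding idempotent_free_def
  proof
    assume "\<exists>e\<in>S. e \<cdot> e = e"
    then obtain e where e: "e \<in> S" "e \<cdot> e = e" by auto
    then have "mm (e, cls e) (e, cls e) = (e, cls e)" by (simp add: mult_P_cls)
    moreover have "(e, cls e) \<in> M" using e cls_in by (simp add: in_rees)
    ultimately show False using free unfolding idempotent_free_def by blast
  qed
next
  assume free: "idempotent_free S mult"
  show "idempotent_free M mm"
    unfolding idempotent_free_def
  proof
    assume "\<exists>e\<in>M. mm e e = e"
    then obtain s i where M: "s \<in> S" "i \<in> \<Lambda>" and e: "s \<cdot> P i \<cdot> s = s"
      by (auto simp: rees_carrier_def)
    have p: "P i \<in> S" using M P_closed by simp
    have "P i \<cdot> s \<cdot> (P i \<cdot> s) = P i \<cdot> (s \<cdot> P i \<cdot> s)" using M p closed by (simp add: assoc)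
    also have "\<dots> = P i \<cdot> s" using e by simp
    finally show False using free M p closed unfolding idempotent_free_def by blast
  qed
qed

text \<open>The equation \<open>(t, [s]) (a, j) = (t, [s]) (b, j)\<close> reads \<open>t s a = t s b\<close>, and \<open>(a, b)\<close> lies in the
  colon congruence when this holds for all \<open>t\<close> and \<open>s\<close>. If \<open>x a\<close> and \<open>x b\<close> are related, then the
  equation holds at \<open>(t, [s x])\<close>, and Cohn's condition moves it to \<open>(t, [s])\<close>. Conversely, an equation
  \<open>(s, i) (a, j) = (s, i) (b, j')\<close> reads \<open>x a = x b\<close> with \<open>x = s P(i)\<close>, so that \<open>a\<close> and \<open>b\<close> are related
  by left cancellation.\<close>

lemma equalized_uniformly_rees_iff:
  "equalized_uniformly M mm \<longleftrightarrow>
     left_cancellative_cong S mult (right_colon S mult (theta S mult))"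
proof
  assume eu: "equalized_uniformly M mm"
  show "left_cancellative_cong S mult (right_colon S mult (theta S mult))"
    unfolding left_cancellative_cong_def
  proof (intro ballI impI)
    fix x a b assume S: "x \<in> S" "a \<in> S" "b \<in> S"
      and xab: "(x \<cdot> a, x \<cdot> b) \<in> right_colon S mult (theta S mult)"
    have "t \<cdot> s \<cdot> a = t \<cdot> s \<cdot> b" if ts: "t \<in> S" "s \<in> S" for t s
    proof -
      have sx: "s \<cdot> x \<in> S" using ts S closed by simp
      have "t \<cdot> s \<cdot> (x \<cdot> a) = t \<cdot> s \<cdot> (x \<cdot> b)" using xab ts by (simp add: in_right_colon_theta)
      then have "t \<cdot> (s \<cdot> x) \<cdot> a = t \<cdot> (s \<cdot> x) \<cdot> b" using ts S closed by (simp add: assoc)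
      then have "mm (t, cls (s \<cdot> x)) (a, cls a) = mm (t, cls (s \<cdot> x)) (b, cls a)"
        using ts sx by (simp add: mult_P_cls)
      from equalized_uniformlyD[OF eu this, of "(t, cls s)"]
      have "mm (t, cls s) (a, cls a) = mm (t, cls s) (b, cls a)"
        using ts S sx cls_in by (simp add: in_rees)
      then show ?thesis using ts by (simp add: mult_P_cls)
    qed
    then show "(a, b) \<in> right_colon S mult (theta S mult)"
      using S by (simp add: in_right_colon_theta)
  qed
next
  assume lc: "left_cancellative_cong S mult (right_colon S mult (theta S mult))"
  have transfer: "mm (t, l) (a, j) = mm (t, l) (b, j')"
    if h: "(s, i) \<in> M" "(a, j) \<in> M" "(b, j') \<in> M" "(t, l) \<in> M"
      and e: "mm (s, i) (a, j) = mm (s, i) (b, j')" for s i a j b j' t l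
  proof -
    have S: "s \<in> S" "a \<in> S" "b \<in> S" "t \<in> S" "P i \<in> S" "P l \<in> S"
      using h P_closed by (auto simp: in_rees)
    define x where "x = s \<cdot> P i"
    have x: "x \<in> S" and xab: "x \<cdot> a = x \<cdot> b" using e S closed by (auto simp: x_def)
    have "(x \<cdot> a, x \<cdot> b) \<in> right_colon S mult (theta S mult)"
      using x xab S closed by (simp add: in_right_colon_theta)
    then have "(a, b) \<in> right_colon S mult (theta S mult)"
      using lc x S unfolding left_cancellative_cong_def by blast
    then show ?thesis using e S by (simp add: in_right_colon_theta)
  qed
  show "equalized_uniformly M mm"
  proof (rule equalized_uniformlyI)
    fix x a b y assume h: "x \<in> M" "a \<in> M" "b \<in> M" "mm x a = mm x b" "y \<in> M"
    show "mm y a = mm y b"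
      using transfer[of "fst x" "snd x" "fst a" "snd a" "fst b" "snd b" "fst y" "snd y"] h
      unfolding prod.collapse by blast
  qed
qed

lemma rees_card:
  assumes "infinite S" shows "|M| \<le>o |S|"
proof -
  have "\<Lambda> = cls ` S" by (auto simp: quotient_def cls_def)
  then have "|\<Lambda>| \<le>o |S|" by (simp add: card_of_image)
  then show ?thesis unfolding rees_carrier_def
    by (intro card_of_Sigma_ordLeq_infinite assms ballI) (simp_all add: card_of_mono1)
qed

lemma embeddable_imp_conditions:
  assumes "embeddable_idempotent_free_left_simple TYPE('b) M mm"
  shows "idempotent_free S mult \<and>
    left_cancellative_cong S mult (right_colon S mult (theta S mult))"
  using embeddable_imp_cohn_conditions[OF semigroup_rees assms]
  by (simp add: idempotent_free_rees_iff equalized_uniformly_rees_iff)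

lemma conditions_imp_embeddable:
  assumes "idempotent_free S mult"
    and "left_cancellative_cong S mult (right_colon S mult (theta S mult))"
  shows "embeddable_idempotent_free_left_simple TYPE('a \<times> 'a set) M mm"
proof -
  interpret rees: cohn_semigroup M mm
    using semigroup_rees assms
    by (simp add: cohn_semigroup_def cohn_semigroup_axioms_def
        idempotent_free_rees_iff equalized_uniformly_rees_iff)
  have "infinite S"
  proof
    assume "finite S"
    moreover have "\<Lambda> = cls ` S" by (auto simp: quotient_def cls_def)
    ultimately have "finite M" by (simp add: rees_carrier_def)
    then show False using rees.infinite_carrier by simp
  qed
  then show ?thesis using rees_card by (intro rees.embeddable_in_powerset)
qed

end

theorem theorem2:
  fixes S :: "'a set" and mult :: "'a \<Rightarrow> 'a \<Rightarrow> 'a" and P :: "'a set \<Rightarrow> 'a"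
  assumes "semigroup_on S mult"
    and "class_choice S (theta S mult) P"
  shows "(embeddable_idempotent_free_left_simple TYPE('a \<times> 'a set)
            (rees_carrier S (S // theta S mult)) (rees_mult mult P)
          \<longleftrightarrow> idempotent_free S mult \<and>
              left_cancellative_cong S mult (right_colon S mult (theta S mult)))
       \<and> (embeddable_idempotent_free_left_simple TYPE('b)
            (rees_carrier S (S // theta S mult)) (rees_mult mult P)
          \<longrightarrow> idempotent_free S mult \<and>
              left_cancellative_cong S mult (right_colon S mult (theta S mult)))"
proof -
  interpret theta_choice S mult P
    using assms by (simp add: theta_choice_def theta_choice_axioms_def)
  show ?thesis
    using embeddable_imp_conditions[where ?'b = "'a \<times> 'a set"]
      embeddable_imp_conditions[where ?'b = 'b] conditions_imp_embeddable
    by blast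
qed

end
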